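(* Let $\delta$ be a range map and let $\mathcal{S}$ be a straight and coated graded subset of $\mathsf{Cl}_\delta$. For any $n \geq 0$, the map $\lambda_{\mathcal{S}} : \lessdot_{\mathcal{S}} \to \mathbb{Z}^2$ defined, for any pair $(u, v)$ of elements of $\mathcal{S}(n)$ with $u \lessdot_{\mathcal{S}} v$, by $\lambda_{\mathcal{S}}(u, v) := (-i, u_i)$, where $i$ is the unique position such that $u_i \neq v_i$, is an EL-labeling of $\mathcal{S}(n)$ (where $\mathbb{Z}^2$ is ordered lexicographically). Moreover, between any pair of elements of $\mathcal{S}(n)$ there is at most one saturated chain whose sequence of labels is weakly decreasing.
   Context: A range map is a map $\delta : \mathbb{N}\setminus\{0\} \to \mathbb{N}$ (with $0 \in \mathbb{N}$). A $\delta$-cliff of size $n$ is a word $u = u_1 \cdots u_n$ of integers with $0 \leq u_i \leq \delta(i)$ for all $i \in [n] := \{1,\dots,n\}$; $\mathsf{Cl}_\delta(n)$ is the set of $\delta$-cliffs of size $n$ and $\mathsf{Cl}_\delta = \bigsqcup_{n \geq 0} \mathsf{Cl}_\delta(n)$. It is ordered by $u \preccurlyeq v$ iff $u$ and $v$ have the same size and $u_i \leq v_i$ for all $i$. A graded subset $\mathcal{S}$ of $\mathsf{Cl}_\delta$ is a family $\mathcal{S} = \bigsqcup_{n\ge 0}\mathcal{S}(n)$ with $\mathcal{S}(n) \subseteq \mathsf{Cl}_\delta(n)$; each $\mathcal{S}(n)$ is a poset for $\preccurlyeq$, and $\lessdot_{\mathcal{S}}$ denotes its covering relation. $\mathcal{S}$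 is straight if for any $n \geq 0$ and $u, v \in \mathcal{S}(n)$ with $u \lessdot_{\mathcal{S}} v$, the words $u$ and $v$ differ in exactly one letter. $\mathcal{S}$ is coated if for any $n \geq 0$, any $u, v \in \mathcal{S}(n)$ with $u \preccurlyeq v$, and any $i \in [n-1]$, the word $u_1 \cdots u_i v_{i+1} \cdots v_n$ belongs to $\mathcal{S}$. An EL-labeling of a finite poset $P$ is a map $\lambda$ from its covering relations to a poset $\Lambda$ such that, for any $x \leq y$ in $P$, there is exactly one saturated chain from $x$ to $y$ whose sequence of labels is weakly increasing, and this sequence of labels is lexicographically smaller than the sequence of labels of every other saturated chain from $x$ to $y$. *)

theory Defs
  imports Main "HOL-Library.Product_Lexorder"
begin

text \<open>Finite posets are given by a carrier \<open>A\<close> and a relation \<open>le\<close> that is only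
  relevant on \<open>A\<close>.\<close>

definition finite_poset :: "'a set \<Rightarrow> ('a \<Rightarrow> 'a \<Rightarrow> bool) \<Rightarrow> bool" where
  "finite_poset A le \<longleftrightarrow> finite A \<and> reflp_on A le \<and> transp_on A le \<and> antisymp_on A le"

definition covers :: "'a set \<Rightarrow> ('a \<Rightarrow> 'a \<Rightarrow> bool) \<Rightarrow> 'a \<Rightarrow> 'a \<Rightarrow> bool" where
  "covers A le x y \<longleftrightarrow> x \<in> A \<and> y \<in> A \<and> le x y \<and> x \<noteq> y \<and>
     \<not> (\<exists>z\<in>A. le x z \<and> le z y \<and> z \<noteq> x \<and> z \<noteq> y)"

definition saturated_chain ::
    "'a set \<Rightarrow> ('a \<Rightarrow> 'a \<Rightarrow> bool) \<Rightarrow> 'a \<Rightarrow> 'a \<Rightarrow> 'a list \<Rightarrow> bool" where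
  "saturated_chain A le x y c \<longleftrightarrow>
     c \<noteq> [] \<and> set c \<subseteq> A \<and> hd c = x \<and> last c = y \<and> successively (covers A le) c"

text \<open>A chain with \<open>k + 1\<close> elements has \<open>k\<close> labels.\<close>

definition chain_labels :: "('a \<Rightarrow> 'a \<Rightarrow> 'l) \<Rightarrow> 'a list \<Rightarrow> 'l list" where
  "chain_labels lam c = map2 lam (butlast c) (tl c)"

text \<open>A labeling is a total function \<open>lam\<close>, but only its values on covering pairs matter.
  The label poset is the type \<open>'l\<close>.\<close>

definition EL_labeling ::
    "'a set \<Rightarrow> ('a \<Rightarrow> 'a \<Rightarrow> bool) \<Rightarrow> ('a \<Rightarrow> 'a \<Rightarrow> 'l::order) \<Rightarrow> bool" where
  "EL_labeling A le lam \<longleftrightarrow> finite_poset A le \<and>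
     (\<forall>x\<in>A. \<forall>y\<in>A. le x y \<longrightarrow>
        (\<exists>!c. saturated_chain A le x y c \<and> sorted_wrt (\<le>) (chain_labels lam c)) \<and>
        (\<forall>c c'. saturated_chain A le x y c \<and> sorted_wrt (\<le>) (chain_labels lam c) \<and>
           saturated_chain A le x y c' \<and> c' \<noteq> c \<longrightarrow>
             (chain_labels lam c, chain_labels lam c') \<in> lexord {(a, b). a < b}))"

text \<open>Letters are numbered from 1.\<close>

definition letter :: "int list \<Rightarrow> nat \<Rightarrow> int" where
  "letter u i = u ! (i - 1)"

text \<open>A range map is a function on all of \<open>nat\<close> whose value at 0 is never used.\<close>

definition cliffs :: "(nat \<Rightarrow> nat) \<Rightarrow> nat \<Rightarrow> int list set" where
  "cliffs \<delta> n = {u. length u = n \<and> (\<forall>i\<in>{1..n}. 0 \<le> letter u i \<and> letter u i \<le> int (\<delta> i))}"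

definition cliff_le :: "int list \<Rightarrow> int list \<Rightarrow> bool" where
  "cliff_le u v \<longleftrightarrow> length u = length v \<and> (\<forall>i\<in>{1..length u}. letter u i \<le> letter v i)"

definition graded_subset :: "(nat \<Rightarrow> nat) \<Rightarrow> (nat \<Rightarrow> int list set) \<Rightarrow> bool" where
  "graded_subset \<delta> S \<longleftrightarrow> (\<forall>n. S n \<subseteq> cliffs \<delta> n)"

definition straight :: "(nat \<Rightarrow> int list set) \<Rightarrow> bool" where
  "straight S \<longleftrightarrow> (\<forall>n. \<forall>u\<in>S n. \<forall>v\<in>S n. covers (S n) cliff_le u v \<longrightarrow>
     (\<exists>!i. i \<in> {1..n} \<and> letter u i \<noteq> letter v i))"

definition coated :: "(nat \<Rightarrow> int list set) \<Rightarrow> bool" where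
  "coated S \<longleftrightarrow> (\<forall>n. \<forall>u\<in>S n. \<forall>v\<in>S n. cliff_le u v \<longrightarrow>
     (\<forall>i\<in>{1..n - 1}. take i u @ drop i v \<in> S n))"

text \<open>The order on \<open>int \<times> int\<close> is the lexicographic one of \<^theory>\<open>HOL-Library.Product_Lexorder\<close>.\<close>

definition cliff_label :: "int list \<Rightarrow> int list \<Rightarrow> int \<times> int" where
  "cliff_label u v =
     (let i = (THE i. i \<in> {1..length u} \<and> letter u i \<noteq> letter v i) in (- int i, letter u i))"

end

theory Submission imports Defs begin

text \<open>By straightness, a saturated chain from \<open>x\<close> to \<open>y\<close> moves one letter at a time, and always
  upwards. The first time the chain changes a position \<open>j\<close>, that position still holds
  \<open>x\<^sub>j\<close>. Hence \<open>(-j, x\<^sub>j)\<close> is a label of \<^emph>\<open>every\<close> saturated chain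
  from \<open>x\<close> to \<open>y\<close>, for every \<open>j\<close> with \<open>x\<^sub>j \<noteq> y\<^sub>j\<close>
  (\<open>initial_letter_is_label\<close>), and all labels \<open>(-j, t)\<close> have
  \<open>x\<^sub>j \<le> t < y\<^sub>j\<close>
  (\<open>chain_label_range\<close>).

  Let \<open>i\<close> be the last position where \<open>x\<close> and \<open>y\<close> differ. Then \<open>(-i, x\<^sub>i)\<close> is the least
  label of every saturated chain from \<open>x\<close> to \<open>y\<close>, so a weakly increasing chain has to start
  with it. It is carried by exactly one cover of \<open>x\<close> below \<open>y\<close>: coatedness provides the word
  \<open>x\<^sub>1 \<cdots> x\<^sub>i\<^sub>-\<^sub>1 y\<^sub>i \<cdots> y\<^sub>n\<close>, which
  differs from \<open>x\<close> only at \<open>i\<close> and thus has a cover of \<open>x\<close> below it, and two covers of \<open>x\<close>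
  raising the same letter are comparable, hence equal. The increasing chain is therefore
  forced at each step, and any other chain has a strictly larger label where it first
  leaves it. This last argument is purely order-theoretic and is isolated in
  \<open>EL_labelingI_least_label\<close>.

  In a weakly decreasing chain, dually, the first step must be at the first position \<open>k\<close>
  where \<open>x\<close> and \<open>y\<close> differ. Labels at a fixed position increase strictly along a chain, so
  position \<open>k\<close> changes only once, from \<open>x\<^sub>k\<close> directly to \<open>y\<^sub>k\<close>
  (\<open>decreasing_chain_first_step\<close>). This determines the first step, and by
  induction the whole chain.\<close>

section \<open>Saturated chains in finite posets\<close>

lemma saturated_chain_induct [consumes 1, case_names single step]:
  assumes "saturated_chain A le x y c"
    and "y \<in> A \<Longrightarrow> P y [y]"
    and "\<And>x a c. covers A le x a \<Longrightarrow> saturated_chain A le a y (a # c) \<Longrightarrow> P a (a # c)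
      \<Longrightarrow> P x (x # a # c)"
  shows "P x c"
  using assms(1)
proof (induction c arbitrary: x)
  case Nil
  then show ?case by (simp add: saturated_chain_def)
next
  case (Cons z c)
  show ?case
  proof (cases c)
    case Nil
    then show ?thesis using Cons.prems assms(2) by (auto simp: saturated_chain_def)
  next
    case (Cons a d)
    have "covers A le x a" "saturated_chain A le a y c" "z = x"
      using Cons.prems Cons by (auto simp: saturated_chain_def)
    then show ?thesis using Cons assms(3) Cons.IH by blast
  qed
qed

lemma saturated_chain_Cons:
  assumes "covers A le x a" and "saturated_chain A le a y c"
  shows "saturated_chain A le x y (x # c)"
  using assms by (cases c) (auto simp: saturated_chain_def covers_def)

lemma saturated_chain_hd: "saturated_chain A le x y c \<Longrightarrow> \<exists>d. c = x # d"
  by (cases c) (auto simp: saturated_chain_def)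

lemma chain_labels_Cons [simp]:
  "chain_labels lam (x # a # c) = lam x a # chain_labels lam (a # c)"
  by (simp add: chain_labels_def)

lemma chain_labels_single [simp]: "chain_labels lam [x] = []"
  by (simp add: chain_labels_def)

lemma saturated_chain_le:
  assumes "finite_poset A le" and "saturated_chain A le x y c"
  shows "x \<in> A \<and> y \<in> A \<and> le x y"
  using assms(2)
proof (induction rule: saturated_chain_induct)
  case single
  then show ?case using assms(1) by (auto simp: finite_poset_def reflp_on_def)
next
  case (step x a c)
  then show ?case using assms(1) unfolding finite_poset_def covers_def transp_on_def by blast
qed

lemma saturated_chain_refl:
  assumes "finite_poset A le"
  shows "saturated_chain A le y y c \<longleftrightarrow> y \<in> A \<and> c = [y]"
proof -
  have "x = y \<longrightarrow> y \<in> A \<and> c = [y]" if "saturated_chain A le x y c" for x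
    using that
  proof (induction rule: saturated_chain_induct)
    case (step x a c)
    then have "le x a" "le a y" "a \<noteq> x" "a \<in> A" "x \<in> A"
      using saturated_chain_le[OF assms] by (auto simp: covers_def)
    then show ?case using assms unfolding finite_poset_def antisymp_on_def by blast
  qed simp
  then show ?thesis by (auto simp: saturated_chain_def)
qed

lemma saturated_chain_step:
  assumes "saturated_chain A le x y c" and "x \<noteq> y"
  obtains a d where "c = x # a # d" "covers A le x a" "saturated_chain A le a y (a # d)"
proof -
  have "x \<noteq> y \<longrightarrow>
      (\<exists>a d. c = x # a # d \<and> covers A le x a \<and> saturated_chain A le a y (a # d))"
    using assms(1) by (induction rule: saturated_chain_induct) auto
  then show thesis using that assms(2) by blast
qed

lemma exists_cover_below:
  assumes "finite_poset A le" and "x \<in> A" "w \<in> A" "le x w" "x \<noteq> w"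
  obtains a where "covers A le x a" "le a w"
proof -
  let ?B = "{z \<in> A. le x z \<and> le z w \<and> z \<noteq> x}"
  have fin: "finite A" and refl: "reflp_on A le" and tr: "transp_on A le"
    and anti: "antisymp_on A le"
    using assms(1) by (auto simp: finite_poset_def)
  have "\<exists>a\<in>?B. \<forall>z\<in>?B. z \<noteq> a \<longrightarrow> \<not> (le z a \<and> z \<noteq> a)"
  proof (rule Finite_Set.bex_min_element)
    show "finite ?B" using fin by simp
    show "?B \<noteq> {}" using assms refl by (auto simp: reflp_on_def)
    show "asymp_on ?B (\<lambda>z a. le z a \<and> z \<noteq> a)"
      using anti by (auto simp: asymp_on_def antisymp_on_def)
    show "transp_on ?B (\<lambda>z a. le z a \<and> z \<noteq> a)"
      using anti tr unfolding transp_on_def antisymp_on_def by blast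
  qed
  then obtain a where a: "a \<in> ?B" "\<And>z. z \<in> ?B \<Longrightarrow> z \<noteq> a \<Longrightarrow> \<not> le z a" by blast
  have "covers A le x a"
    unfolding covers_def
  proof (intro conjI notI)
    assume "\<exists>z\<in>A. le x z \<and> le z a \<and> z \<noteq> x \<and> z \<noteq> a"
    then obtain z where z: "z \<in> A" "le x z" "le z a" "z \<noteq> x" "z \<noteq> a" by blast
    then have "le z w" using tr a(1) assms(3) unfolding transp_on_def by blast
    then show False using a(2) z by blast
  qed (use a(1) assms in auto)
  then show thesis using that a(1) by blast
qed

text \<open>Climbing along covers towards \<open>y\<close> terminates because the finite up-set of the current
  element shrinks strictly.\<close>

lemma poset_descent_induct [consumes 3, case_names le]:
  assumes fp: "finite_poset A le" and "x \<in> A" "le x y"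
    and step: "\<And>x. x \<in> A \<Longrightarrow> le x y \<Longrightarrow>
      (\<And>a. covers A le x a \<Longrightarrow> le a y \<Longrightarrow> P a) \<Longrightarrow> P x"
  shows "P x"
  using assms(2,3)
proof (induction "card {z \<in> A. le x z}" arbitrary: x rule: less_induct)
  case less
  show ?case
  proof (rule step[OF less.prems])
    fix a assume a: "covers A le x a" "le a y"
    have "{z \<in> A. le a z} \<subset> {z \<in> A. le x z}"
    proof (rule psubsetI)
      show "{z \<in> A. le a z} \<subseteq> {z \<in> A. le x z}"
        using fp a(1) unfolding finite_poset_def covers_def transp_on_def by blast
      have "x \<in> {z \<in> A. le x z}" "x \<notin> {z \<in> A. le a z}"
        using fp a(1) unfolding finite_poset_def covers_def antisymp_on_def reflp_on_def by blast+
      then show "{z \<in> A. le a z} \<noteq> {z \<in> A. le x z}" by blast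
    qed
    then have "card {z \<in> A. le a z} < card {z \<in> A. le x z}"
      using fp by (intro psubset_card_mono) (auto simp: finite_poset_def)
    then show "P a" using less.hyps a by (auto simp: covers_def)
  qed
qed

section \<open>A criterion for EL-labelings\<close>

text \<open>If one label is the least on every saturated chain from \<open>x\<close> to \<open>y\<close> and comes from a
  single first step \<open>a\<close>, then an increasing chain can be built greedily, since putting that
  label in front keeps it increasing. An increasing chain must also start with \<open>a\<close>, as its
  first label is bounded by all the others. A chain starting differently loses the
  lexicographic comparison at once, and a chain starting with \<open>a\<close> is handled by induction.\<close>

lemma EL_labelingI_least_label:
  fixes lam :: "'a \<Rightarrow> 'a \<Rightarrow> 'l::order"
  assumes fp: "finite_poset A le"
    and least: "\<And>x y. x \<in> A \<Longrightarrow> y \<in> A \<Longrightarrow> le x y \<Longrightarrow> x \<noteq> y \<Longrightarrow>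
      \<exists>a. covers A le x a \<and> le a y \<and>
        (\<forall>b. covers A le x b \<and> le b y \<and> lam x b = lam x a \<longrightarrow> b = a) \<and>
        (\<forall>c. saturated_chain A le x y c \<longrightarrow> lam x a \<in> set (chain_labels lam c) \<and>
           (\<forall>l\<in>set (chain_labels lam c). lam x a \<le> l))"
  shows "EL_labeling A le lam"
proof -
  have existence: "\<exists>c. saturated_chain A le x y c \<and> sorted_wrt (\<le>) (chain_labels lam c)"
    if "x \<in> A" "y \<in> A" "le x y" for x y
    using fp that(1,3)
  proof (induction rule: poset_descent_induct)
    case (le x)
    show ?case
    proof (cases "x = y")
      case True
      then show ?thesis
        using saturated_chain_refl[OF fp, of y "[y]"] \<open>y \<in> A\<close> by (intro exI[of _ "[y]"]) auto
    next
      case False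
      obtain a where a: "covers A le x a" "le a y"
        "\<And>c. saturated_chain A le x y c \<Longrightarrow> \<forall>l\<in>set (chain_labels lam c). lam x a \<le> l"
        using least[OF le(1) \<open>y \<in> A\<close> le(2) False] by blast
      obtain c where c: "saturated_chain A le a y c" "sorted_wrt (\<le>) (chain_labels lam c)"
        using le(3)[OF a(1,2)] by blast
      obtain d where d: "c = a # d" using saturated_chain_hd[OF c(1)] by blast
      have "saturated_chain A le x y (x # c)"
        using saturated_chain_Cons[OF a(1) c(1)] .
      then show ?thesis using a(3)[of "x # c"] c(2) d by (intro exI[of _ "x # c"]) auto
    qed
  qed
  \<comment> \<open>Uniqueness follows as well: of two distinct increasing chains, each would be strictly
    smaller than the other.\<close>
  have smallest: "c' = c \<or>
      (chain_labels lam c, chain_labels lam c') \<in> lexord {(a, b). a < b}"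
    if "saturated_chain A le x y c" "sorted_wrt (\<le>) (chain_labels lam c)"
      "saturated_chain A le x y c'" for x y c c'
    using that
  proof (induction arbitrary: c' rule: saturated_chain_induct)
    case single
    then show ?case using saturated_chain_refl[OF fp] by blast
  next
    case (step x a c)
    have chain: "saturated_chain A le x y (x # a # c)"
      using saturated_chain_Cons[OF step.hyps] .
    have le: "x \<in> A" "y \<in> A" "le x y" "le a y"
      using saturated_chain_le[OF fp] chain step.hyps by auto
    have "x \<noteq> y" using chain saturated_chain_refl[OF fp] by blast
    obtain m where m: "covers A le x m" "le m y"
      "\<And>b. covers A le x b \<Longrightarrow> le b y \<Longrightarrow> lam x b = lam x m \<Longrightarrow> b = m"
      "\<And>c. saturated_chain A le x y c \<Longrightarrow> lam x m \<in> set (chain_labels lam c)"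
      "\<And>c l. saturated_chain A le x y c \<Longrightarrow> l \<in> set (chain_labels lam c) \<Longrightarrow> lam x m \<le> l"
      using least[OF le(1-3) \<open>x \<noteq> y\<close>] by blast
    \<comment> \<open>The least label occurs somewhere on the chain, and the chain is increasing.\<close>
    have "lam x a \<le> lam x m"
      using m(4)[OF chain] step.prems(1) by auto
    moreover have "lam x m \<le> lam x a" using m(5)[OF chain] by simp
    ultimately have "a = m" using m(3) step.hyps(1) le(4) by simp
    obtain b d where c': "c' = x # b # d" "covers A le x b" "saturated_chain A le b y (b # d)"
      using saturated_chain_step[OF step.prems(2) \<open>x \<noteq> y\<close>] .
    show ?case
    proof (cases "b = a")
      case True
      then show ?thesis using step.IH[of "b # d"] step.prems c' by auto
    next
      case False
      have "lam x b \<noteq> lam x m"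
        using m(3)[OF c'(2)] saturated_chain_le[OF fp c'(3)] False \<open>a = m\<close> by blast
      moreover have "lam x m \<le> lam x b" using m(5)[OF step.prems(2)] c'(1) by simp
      ultimately show ?thesis using \<open>a = m\<close> c'(1) by (simp add: order_less_le)
    qed
  qed
  have asym: "asym (lexord {(a :: 'l, b). a < b})"
    by (intro lexord_asym asymI) auto
  show ?thesis
    unfolding EL_labeling_def
    using fp existence smallest asymD[OF asym] by (smt (verit, best))
qed

section \<open>The componentwise order on words\<close>

lemma eq_iff_letters:
  "length u = length v \<Longrightarrow> u = v \<longleftrightarrow> (\<forall>i\<in>{1..length u}. letter u i = letter v i)"
proof
  assume len: "length u = length v" and *: "\<forall>i\<in>{1..length u}. letter u i = letter v i"
  show "u = v"
  proof (rule nth_equalityI[OF len])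
    fix i assume "i < length u"
    then show "u ! i = v ! i" using *[rule_format, of "Suc i"] by (simp add: letter_def)
  qed
qed auto

lemma finite_cliffs: "finite (cliffs \<delta> n)"
proof (rule finite_subset)
  \<comment> \<open>Any common bound for the letters will do; a sum avoids the empty maximum at \<open>n = 0\<close>.\<close>
  let ?M = "\<Sum>i\<in>{1..n}. int (\<delta> i)"
  show "cliffs \<delta> n \<subseteq> {u. set u \<subseteq> {0..?M} \<and> length u = n}"
  proof safe
    fix u k assume u: "u \<in> cliffs \<delta> n" and "k \<in> set u"
    then obtain i where i: "i < n" "k = letter u (Suc i)"
      by (auto simp: cliffs_def in_set_conv_nth letter_def)
    then have "0 \<le> k" "k \<le> int (\<delta> (Suc i))" using u by (auto simp: cliffs_def)
    moreover have "int (\<delta> (Suc i)) \<le> ?M"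
      using i by (intro member_le_sum) auto
    ultimately show "k \<in> {0..?M}" by auto
  qed (simp add: cliffs_def)
  show "finite {u. set u \<subseteq> {0..?M} \<and> length u = n}"
    by (rule finite_lists_length_eq) simp
qed

lemma finite_poset_cliffs:
  assumes "graded_subset \<delta> S"
  shows "finite_poset (S n) cliff_le"
proof -
  have "finite (S n)"
    using assms finite_cliffs finite_subset unfolding graded_subset_def by blast
  moreover have "antisymp_on (S n) cliff_le"
    unfolding antisymp_on_def cliff_le_def using eq_iff_letters by (metis order_antisym)
  moreover have "transp_on (S n) cliff_le"
    unfolding transp_on_def cliff_le_def by (metis order_trans)
  ultimately show ?thesis
    by (auto simp: finite_poset_def reflp_on_def cliff_le_def)
qed

lemma length_graded: "graded_subset \<delta> S \<Longrightarrow> u \<in> S n \<Longrightarrow> length u = n"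
  by (auto simp: graded_subset_def cliffs_def)

section \<open>Labels along saturated chains of cliffs\<close>

lemma straight_coverE:
  assumes "graded_subset \<delta> S" "straight S" and cov: "covers (S n) cliff_le u v"
  obtains i where "i \<in> {1..n}" "letter u i < letter v i"
    "\<And>j. j \<in> {1..n} \<Longrightarrow> j \<noteq> i \<Longrightarrow> letter u j = letter v j"
    "cliff_label u v = (- int i, letter u i)"
proof -
  have uv: "u \<in> S n" "v \<in> S n" "cliff_le u v" using cov by (auto simp: covers_def)
  then have len: "length u = n" using length_graded assms(1) by blast
  have ex1: "\<exists>!i. i \<in> {1..n} \<and> letter u i \<noteq> letter v i"
    using assms(2) cov uv unfolding straight_def by blast
  then obtain i where i: "i \<in> {1..n} \<and> letter u i \<noteq> letter v i" by blast
  have "(THE i. i \<in> {1..length u} \<and> letter u i \<noteq> letter v i) = i"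
    unfolding len using ex1 i by (rule the1_equality)
  then have "cliff_label u v = (- int i, letter u i)"
    by (simp add: cliff_label_def)
  moreover have "letter u i < letter v i"
    using i uv(3) len by (simp add: cliff_le_def order_less_le)
  ultimately show thesis using that[of i] i ex1 by blast
qed

text \<open>Letters only grow along a chain, so the letter that a step replaces lies between the
  initial and the final one; it is strictly below the latter because the step raises it.\<close>

lemma chain_label_range:
  assumes "graded_subset \<delta> S" "straight S"
    and "saturated_chain (S n) cliff_le x y c" and "l \<in> set (chain_labels cliff_label c)"
  shows "\<exists>i\<in>{1..n}. \<exists>t. l = (- int i, t) \<and> letter x i \<le> t \<and> t < letter y i"
  using assms(3,4)
proof (induction rule: saturated_chain_induct)
  case (step x a c)
  note fp = finite_poset_cliffs[OF assms(1), of n]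
  have "a \<in> S n" "cliff_le a y" "cliff_le x a" "x \<in> S n"
    using saturated_chain_le[OF fp step.hyps(2)] step.hyps(1) by (auto simp: covers_def)
  then have le: "letter x i \<le> letter a i" "letter a i \<le> letter y i" if "i \<in> {1..n}" for i
    using that length_graded[OF assms(1)] by (auto simp: cliff_le_def)
  obtain i where i: "i \<in> {1..n}" "letter x i < letter a i"
      "cliff_label x a = (- int i, letter x i)"
    using straight_coverE[OF assms(1,2) step.hyps(1)] by blast
  show ?case
  proof (cases "l = cliff_label x a")
    case True
    then show ?thesis using i le(2)[OF i(1)] by auto
  next
    case False
    then show ?thesis using step le(1) by (fastforce intro: order_trans)
  qed
qed simp

text \<open>The label in question is that of the first step changing position \<open>j\<close>; up to that step the
  position holds its initial letter.\<close>

lemma initial_letter_is_label: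
  assumes "graded_subset \<delta> S" "straight S"
    and "saturated_chain (S n) cliff_le x y c"
    and "j \<in> {1..n}" "letter x j \<noteq> letter y j"
  shows "(- int j, letter x j) \<in> set (chain_labels cliff_label c)"
  using assms(3,5)
proof (induction rule: saturated_chain_induct)
  case (step x a c)
  obtain i where i: "i \<in> {1..n}" 
      "\<And>j. j \<in> {1..n} \<Longrightarrow> j \<noteq> i \<Longrightarrow> letter x j = letter a j"
      "cliff_label x a = (- int i, letter x i)"
    using straight_coverE[OF assms(1,2) step.hyps(1)] by blast
  then show ?case using step assms(4) by (cases "j = i") auto
qed simp

text \<open>Equal labels mean that both covers raise the same letter of \<open>x\<close>. They are then comparable,
  and neither can lie strictly between \<open>x\<close> and the other.\<close>

lemma cliff_label_inj_on_covers:
  assumes "graded_subset \<delta> S" "straight S"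
    and a: "covers (S n) cliff_le x a" and b: "covers (S n) cliff_le x b"
    and eq: "cliff_label x a = cliff_label x b"
  shows "a = b"
proof -
  obtain i where i: "i \<in> {1..n}" "letter x i < letter a i"
      "\<And>j. j \<in> {1..n} \<Longrightarrow> j \<noteq> i \<Longrightarrow> letter x j = letter a j"
      "cliff_label x a = (- int i, letter x i)"
    using straight_coverE[OF assms(1,2) a] by blast
  obtain k where k: "k \<in> {1..n}" "letter x k < letter b k"
      "\<And>j. j \<in> {1..n} \<Longrightarrow> j \<noteq> k \<Longrightarrow> letter x j = letter b j"
      "cliff_label x b = (- int k, letter x k)"
    using straight_coverE[OF assms(1,2) b] by blast
  have "k = i" using eq i k by simp
  have len: "length a = n" "length b = n" and ab: "a \<in> S n" "b \<in> S n"
    and x: "cliff_le x a" "cliff_le x b" "x \<noteq> a" "x \<noteq> b"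
    using a b length_graded[OF assms(1)] by (auto simp: covers_def)
  have "letter a j = letter b j" if "j \<in> {1..n}" "j \<noteq> i" for j
    using i(3) k(3) that \<open>k = i\<close> by metis
  then have "cliff_le a b \<or> cliff_le b a"
    unfolding cliff_le_def len by (metis linear order_refl)
  then show ?thesis using a b ab x unfolding covers_def by metis
qed

text \<open>Here coatedness enters: the word taking its first \<open>i - 1\<close> letters from \<open>x\<close> and the others
  from \<open>y\<close> belongs to \<open>S n\<close> and differs from \<open>x\<close> at \<open>i\<close> only, so any cover of \<open>x\<close> below it
  must change position \<open>i\<close>.\<close>

lemma cover_at_last_difference:
  assumes "graded_subset \<delta> S" "straight S" "coated S"
    and xy: "x \<in> S n" "y \<in> S n" "cliff_le x y"
    and i: "i \<in> {1..n}" "letter x i \<noteq> letter y i"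
    and last: "\<And>j. j \<in> {1..n} \<Longrightarrow> i < j \<Longrightarrow> letter x j = letter y j"
  obtains a where "covers (S n) cliff_le x a" "cliff_le a y"
    "cliff_label x a = (- int i, letter x i)"
proof -
  note fp = finite_poset_cliffs[OF assms(1), of n]
  have len: "length x = n" "length y = n" using xy length_graded[OF assms(1)] by auto
  define w where "w = take (i - 1) x @ drop (i - 1) y"
  have w: "w \<in> S n"
    \<comment> \<open>Coatedness speaks of proper nonempty prefixes; for the empty one the word is \<open>y\<close>.\<close>
  proof (cases "i = 1")
    case True
    then show ?thesis using xy by (simp add: w_def)
  next
    case False
    then have "i - 1 \<in> {1..n - 1}" using i by auto
    then show ?thesis using assms(3) xy unfolding coated_def w_def by blast
  qed
  have letter_w: "letter w j = (if j < i then letter x j else letter y j)"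
    if "j \<in> {1..n}" for j
    using that i len by (auto simp: w_def letter_def nth_append)
  have le: "letter x j \<le> letter y j" if "j \<in> {1..n}" for j
    using that xy(3) len by (simp add: cliff_le_def)
  have len_w: "length w = n" using w length_graded[OF assms(1)] by blast
  have w_x: "letter w j = letter x j" if "j \<in> {1..n}" "j \<noteq> i" for j
    using letter_w[OF that(1)] last[of j] that by auto
  have "cliff_le x w" "cliff_le w y"
    unfolding cliff_le_def len len_w using letter_w le by auto
  moreover have "x \<noteq> w" using letter_w[OF i(1)] i(2) by auto
  ultimately obtain a where a: "covers (S n) cliff_le x a" "cliff_le a w"
    using exists_cover_below[OF fp xy(1) w] by blast
  have "a \<in> S n" using a(1) by (simp add: covers_def)
  have "cliff_le a y"
    using a(2) \<open>cliff_le w y\<close> fp \<open>a \<in> S n\<close> w xy(2)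
    unfolding finite_poset_def transp_on_def by blast
  obtain k where k: "k \<in> {1..n}" "letter x k < letter a k"
      "cliff_label x a = (- int k, letter x k)"
    using straight_coverE[OF assms(1,2) a(1)] by blast
  have "letter a k \<le> letter w k"
    using a(2) k(1) length_graded[OF assms(1) \<open>a \<in> S n\<close>] by (simp add: cliff_le_def)
  then have "k = i" using w_x[OF k(1)] k(2) by fastforce
  then show thesis using that a(1) \<open>cliff_le a y\<close> k(3) by blast
qed

lemma last_difference:
  assumes "length x = n" "length y = n" "x \<noteq> y"
  obtains i where "i \<in> {1..n}" "letter x i \<noteq> letter y i"
    "\<And>j. j \<in> {1..n} \<Longrightarrow> i < j \<Longrightarrow> letter x j = letter y j"
proof -
  let ?D = "{i \<in> {1..n}. letter x i \<noteq> letter y i}"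
  have fin: "finite ?D" by simp
  have "?D \<noteq> {}" using eq_iff_letters[of x y] assms by auto
  then have "Max ?D \<in> ?D" using Max_in[OF fin] by blast
  moreover have "j \<notin> ?D" if "Max ?D < j" for j using Max_ge[OF fin, of j] that by linarith
  ultimately show thesis using that[of "Max ?D"] by blast
qed

lemma cliff_label_EL:
  assumes "graded_subset \<delta> S" "straight S" "coated S"
  shows "EL_labeling (S n) cliff_le cliff_label"
proof (rule EL_labelingI_least_label)
  show fp: "finite_poset (S n) cliff_le" using finite_poset_cliffs[OF assms(1)] .
  fix x y assume xy: "x \<in> S n" "y \<in> S n" "cliff_le x y" "x \<noteq> y"
  obtain i where i: "i \<in> {1..n}" "letter x i \<noteq> letter y i"
    "\<And>j. j \<in> {1..n} \<Longrightarrow> i < j \<Longrightarrow> letter x j = letter y j"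
    using last_difference xy length_graded[OF assms(1)] by metis
  obtain a where a: "covers (S n) cliff_le x a" "cliff_le a y"
    "cliff_label x a = (- int i, letter x i)"
    using cover_at_last_difference[OF assms xy(1-3) i] by blast
  have "cliff_label x a \<le> l"
    if c: "saturated_chain (S n) cliff_le x y c" "l \<in> set (chain_labels cliff_label c)" for c l
  proof -
    obtain j t where j: "j \<in> {1..n}" "l = (- int j, t)" "letter x j \<le> t" "t < letter y j"
      using chain_label_range[OF assms(1,2) c] by blast
    then have "j \<le> i" using i(3)[of j] by fastforce
    then show ?thesis using j a(3) by (auto simp: less_le)
  qed
  moreover have "cliff_label x a \<in> set (chain_labels cliff_label c)"
    if "saturated_chain (S n) cliff_le x y c" for c
    using initial_letter_is_label[OF assms(1,2) that i(1,2)] a(3) by simp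
  ultimately show "\<exists>a. covers (S n) cliff_le x a \<and> cliff_le a y \<and>
      (\<forall>b. covers (S n) cliff_le x b \<and> cliff_le b y \<and> cliff_label x b = cliff_label x a
        \<longrightarrow> b = a) \<and>
      (\<forall>c. saturated_chain (S n) cliff_le x y c \<longrightarrow>
        cliff_label x a \<in> set (chain_labels cliff_label c) \<and>
        (\<forall>l\<in>set (chain_labels cliff_label c). cliff_label x a \<le> l))"
    using a cliff_label_inj_on_covers[OF assms(1,2)] by blast
qed

section \<open>Decreasing chains\<close>

text \<open>No later label exceeds the first one, \<open>(-k, x\<^sub>k)\<close>. If position \<open>k\<close> had not reached
  \<open>y\<^sub>k\<close> yet, the later label \<open>(-k, a\<^sub>k)\<close> would exceed it; and for
  a differing position \<open>j < k\<close> the label \<open>(-j, x\<^sub>j)\<close> would.\<close>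

lemma decreasing_chain_first_step:
  assumes "graded_subset \<delta> S" "straight S"
    and cov: "covers (S n) cliff_le x a" and chain: "saturated_chain (S n) cliff_le a y (a # c)"
    and dec: "sorted_wrt (\<ge>) (chain_labels cliff_label (x # a # c))"
  obtains k where "k \<in> {1..n}" "letter x k \<noteq> letter y k" "letter a k = letter y k"
    "\<And>j. j \<in> {1..n} \<Longrightarrow> j \<noteq> k \<Longrightarrow> letter a j = letter x j"
    "\<And>j. j \<in> {1..n} \<Longrightarrow> letter x j \<noteq> letter y j \<Longrightarrow> k \<le> j"
proof -
  note fp = finite_poset_cliffs[OF assms(1), of n]
  obtain k where k: "k \<in> {1..n}" "letter x k < letter a k"
      "\<And>j. j \<in> {1..n} \<Longrightarrow> j \<noteq> k \<Longrightarrow> letter x j = letter a j"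
      "cliff_label x a = (- int k, letter x k)"
    using straight_coverE[OF assms(1,2) cov] by blast
  have "letter a k \<le> letter y k"
    using saturated_chain_le[OF fp chain] k(1) length_graded[OF assms(1)]
    by (auto simp: cliff_le_def)
  have later: "l \<le> (- int k, letter x k)" if "l \<in> set (chain_labels cliff_label (a # c))" for l
    using dec that k(4) by simp
  have "letter a k = letter y k"
  proof (rule ccontr)
    assume "letter a k \<noteq> letter y k"
    then have "(- int k, letter a k) \<le> (- int k, letter x k)"
      using later initial_letter_is_label[OF assms(1,2) chain k(1)] by blast
    then show False using k(2) by simp
  qed
  moreover have "k \<le> j" if "j \<in> {1..n}" "letter x j \<noteq> letter y j" for j
  proof -
    have "(- int j, letter x j) \<in> set (chain_labels cliff_label (x # a # c))"
      using initial_letter_is_label[OF assms(1,2) saturated_chain_Cons[OF cov chain] that] .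
    then have "(- int j, letter x j) \<le> (- int k, letter x k)"
      using later k(4) by (metis chain_labels_Cons order_refl set_ConsD)
    then show ?thesis by auto
  qed
  ultimately show thesis
    using that[of k] k(1-3) \<open>letter a k \<le> letter y k\<close> by force
qed

lemma decreasing_chain_unique:
  assumes "graded_subset \<delta> S" "straight S"
    and "saturated_chain (S n) cliff_le x y c" "sorted_wrt (\<ge>) (chain_labels cliff_label c)"
    and "saturated_chain (S n) cliff_le x y c'" "sorted_wrt (\<ge>) (chain_labels cliff_label c')"
  shows "c' = c"
  using assms(3-6)
proof (induction arbitrary: c' rule: saturated_chain_induct)
  case single
  then show ?case using saturated_chain_refl[OF finite_poset_cliffs[OF assms(1)]] by blast
next
  case (step x a c)
  note fp = finite_poset_cliffs[OF assms(1), of n]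
  have "x \<noteq> y"
    using saturated_chain_Cons[OF step.hyps] saturated_chain_refl[OF fp] by blast
  then obtain b d where
    c': "c' = x # b # d" "covers (S n) cliff_le x b" "saturated_chain (S n) cliff_le b y (b # d)"
    using saturated_chain_step[OF step.prems(2)] by blast
  obtain k where k: "k \<in> {1..n}" "letter x k \<noteq> letter y k" "letter a k = letter y k"
    "\<And>j. j \<in> {1..n} \<Longrightarrow> j \<noteq> k \<Longrightarrow> letter a j = letter x j"
    "\<And>j. j \<in> {1..n} \<Longrightarrow> letter x j \<noteq> letter y j \<Longrightarrow> k \<le> j"
    using decreasing_chain_first_step[OF assms(1,2) step.hyps step.prems(1)] by blast
  obtain m where m: "m \<in> {1..n}" "letter x m \<noteq> letter y m" "letter b m = letter y m"
    "\<And>j. j \<in> {1..n} \<Longrightarrow> j \<noteq> m \<Longrightarrow> letter b j = letter x j"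
    "\<And>j. j \<in> {1..n} \<Longrightarrow> letter x j \<noteq> letter y j \<Longrightarrow> m \<le> j"
    using decreasing_chain_first_step[OF assms(1,2) c'(2,3)] step.prems(3) c'(1) by blast
  have "m = k" using k m by (metis order_antisym)
  have "length a = n" "length b = n"
    using step.hyps(1) c'(2) length_graded[OF assms(1)] by (auto simp: covers_def)
  moreover have "\<forall>j\<in>{1..n}. letter a j = letter b j"
    using k(3,4) m(3,4) \<open>m = k\<close> by metis
  ultimately have "b = a" using eq_iff_letters[of a b] by simp
  then show ?case using step.IH[of "b # d"] step.prems c' by auto
qed

theorem theorem1p2p1:
  fixes \<delta> :: "nat \<Rightarrow> nat" and S :: "nat \<Rightarrow> int list set" and n :: nat
  assumes "graded_subset \<delta> S" and "straight S" and "coated S"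
  shows "EL_labeling (S n) cliff_le cliff_label \<and>
    (\<forall>x\<in>S n. \<forall>y\<in>S n. \<exists>\<^sub>\<le>\<^sub>1c. saturated_chain (S n) cliff_le x y c \<and>
       sorted_wrt (\<ge>) (chain_labels cliff_label c))"
  using cliff_label_EL[OF assms] decreasing_chain_unique[OF assms(1,2)]
  unfolding Uniq_def by blast

end
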